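(* Let $\mathcal{X}$ be a Polish space and $G$ a locally compact, $\sigma$-compact, Hausdorff, unimodular topological group acting on $\mathcal{X}$ by a jointly measurable action $\varphi$. Let $k:\mathcal{X}\times\mathcal{X}\to\mathbb{R}$ be a positive definite kernel and $\rho:\mathcal{X}\to(0,\infty)$ a strictly positive function, and assume that $k$ and $\rho$ are continuous and bounded. Let $\nu\in\mathcal{M}^\rho(G)$ and let $\Phi^\rho:x\mapsto k^\rho(x,\cdot)$ be the canonical feature map of $k^\rho$. Then, for all $x,y\in\mathcal{X}$, $$k^\rho_\nu(x,y)=\left\langle\Phi^\rho_\nu(x),\Phi^\rho_\nu(y)\right\rangle_{\mathcal{H}^\rho_k},\qquad\text{where}\quad \Phi^\rho_\nu:x\mapsto\int_G\Phi^\rho(\varphi_g(x))\,\mathrm{d}\nu(g).$$ In other words, $\Phi^\rho_\nu$ is the canonical feature map of $k^\rho_\nu$. In particular, $k^\rho_\nu$ is a positive definite kernel on $\mathcal{X}$.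
   Context: Standing setting. $G$ is a topological group that is locally compact, Hausdorff, $\sigma$-compact and unimodular. $\mathcal{X}$ is a Polish space with Borel $\sigma$-algebra $\mathcal{B}(\mathcal{X})$. A (left) action of $G$ on $\mathcal{X}$ is a map $\varphi:G\times\mathcal{X}\to\mathcal{X}$, $(g,x)\mapsto\varphi_g(x)$, with $\varphi_e=\mathrm{id}_{\mathcal{X}}$ (where $e$ is the identity of $G$) and $\varphi_{gh}=\varphi_g\circ\varphi_h$ for all $g,h\in G$; it is assumed jointly measurable with respect to the product $\sigma$-algebra on $G\times\mathcal{X}$. Positive definite kernel: a symmetric function $k$ with $\sum_{i,j}a_ia_jk(x_i,x_j)\ge 0$ for all finite families of points $x_i$ and reals $a_i$. $\mathcal{M}^\rho(G)$ is the set of $\sigma$-finite (nonnegative) Borel measures $\nu$ on $G$ such that $\sup_{x\in\mathcal{X}}\int_G\rho(\varphi_g(x))\,\mathrm{d}\nu(g)<\infty$. The weighted kernel is $k^\rho(x,y)=\rho(x)k(x,y)\rho(y)$, with reproducing kernel Hilbert space denoted $\mathcal{H}^\rho_k$; its canonical feature map is the map $x\mapsto k^\rho(x,\cdot)$ from $\mathcal{X}$ to $\mathcal{H}^\rho_k$. For $\nu\in\mathcal{M}^\rho(G)$ the $\nu$-averaged kernel is $k^\rho_\nu(x,y)=\int_G\int_G k^\rho(\varphi_g(x),\varphi_h(y))\,\mathrm{d}\nu(g)\,\mathrm{d}\nu(h)$. The integral defining $\Phi^\rho_\nu(x)$ is a Bochner integral in $\mathcal{H}^\rho_k$. The sentence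 calling $\Phi^\rho_\nu$ the canonical feature map of $k^\rho_\nu$ is introduced by "In other words", i.e. it is offered as a rewording of the displayed identity. *)

theory Defs
  imports "HOL-Analysis.Analysis"
begin

section \<open>The group and its action\<close>

text \<open>
  Groups are written additively, since \<^class>\<open>topological_group_add\<close> is the library's class of
  topological groups; it does not include commutativity.
\<close>

definition sigma_compact_space :: "'a topology \<Rightarrow> bool" where
  "sigma_compact_space X \<longleftrightarrow>
     (\<exists>K :: nat \<Rightarrow> 'a set. (\<forall>n. compactin X (K n)) \<and> (\<Union>n. K n) = topspace X)"

definition left_haar_measure :: "'g::topological_group_add measure \<Rightarrow> bool" where
  "left_haar_measure \<mu> \<longleftrightarrow>
     sets \<mu> = sets borel \<and>
     (\<forall>K. compact K \<longrightarrow> K \<in> sets borel \<longrightarrow> emeasure \<mu> K < \<infinity>) \<and>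
     (\<forall>A\<in>sets borel. emeasure \<mu> A = (INF U\<in>{U. open U \<and> A \<subseteq> U}. emeasure \<mu> U)) \<and>
     (\<forall>U. open U \<longrightarrow>
        emeasure \<mu> U = (SUP K\<in>{K. compact K \<and> K \<in> sets borel \<and> K \<subseteq> U}. emeasure \<mu> K)) \<and>
     emeasure \<mu> UNIV \<noteq> 0 \<and>
     (\<forall>g. \<forall>A\<in>sets borel. emeasure \<mu> ((\<lambda>h. g + h) ` A) = emeasure \<mu> A)"

text \<open>
  Left Haar measures are unique up to a positive factor, so it does not matter which one is tested
  for right invariance.
\<close>

definition unimodular_group :: "'g::topological_group_add itself \<Rightarrow> bool" where
  "unimodular_group _ \<longleftrightarrow>
     (\<exists>\<mu> :: 'g measure. left_haar_measure \<mu> \<and>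
        (\<forall>g. \<forall>A\<in>sets borel. emeasure \<mu> ((\<lambda>h. h + g) ` A) = emeasure \<mu> A))"

definition measurable_action ::
    "('g::topological_group_add \<Rightarrow> 'x::topological_space \<Rightarrow> 'x) \<Rightarrow> bool" where
  "measurable_action \<phi> \<longleftrightarrow>
     \<phi> 0 = id \<and> (\<forall>g h. \<phi> (g + h) = \<phi> g \<circ> \<phi> h) \<and>
     (\<lambda>(g, x). \<phi> g x) \<in> borel_measurable (borel \<Otimes>\<^sub>M borel)"

definition M_rho ::
    "('g::topological_group_add \<Rightarrow> 'x \<Rightarrow> 'x) \<Rightarrow> ('x \<Rightarrow> real) \<Rightarrow> 'g measure set" where
  "M_rho \<phi> \<rho> = {\<nu>. sets \<nu> = sets borel \<and> sigma_finite_measure \<nu> \<and>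
     (SUP x. \<integral>\<^sup>+ g. ennreal (\<rho> (\<phi> g x)) \<partial>\<nu>) < \<infinity>}"


section \<open>Kernels\<close>

definition pos_def_kernel :: "('x \<Rightarrow> 'x \<Rightarrow> real) \<Rightarrow> bool" where
  "pos_def_kernel k \<longleftrightarrow>
     (\<forall>x y. k x y = k y x) \<and>
     (\<forall>(n::nat) (p :: nat \<Rightarrow> 'x) (a :: nat \<Rightarrow> real).
        (\<Sum>i<n. \<Sum>j<n. a i * a j * k (p i) (p j)) \<ge> 0)"

definition weighted_kernel :: "('x \<Rightarrow> 'x \<Rightarrow> real) \<Rightarrow> ('x \<Rightarrow> real) \<Rightarrow> 'x \<Rightarrow> 'x \<Rightarrow> real" where
  "weighted_kernel k \<rho> x y = \<rho> x * k x y * \<rho> y"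

definition averaged_kernel ::
    "'g measure \<Rightarrow> ('g \<Rightarrow> 'x \<Rightarrow> 'x) \<Rightarrow> ('x \<Rightarrow> 'x \<Rightarrow> real) \<Rightarrow> 'x \<Rightarrow> 'x \<Rightarrow> real" where
  "averaged_kernel \<nu> \<phi> K x y = (\<integral>h. (\<integral>g. K (\<phi> g x) (\<phi> h y) \<partial>\<nu>) \<partial>\<nu>)"


section \<open>Hilbert spaces of functions and reproducing kernels\<close>

text \<open>
  A Hilbert space of real functions on \<open>'x\<close> is a set \<open>H\<close> of functions with an inner product \<open>ip\<close>
  that is only relevant on \<open>H\<close>.  It is not rendered as a type of class \<^class>\<open>real_inner\<close>, because the
  reproducing kernel Hilbert space of \<open>K\<close> depends on the term \<open>K\<close>.
\<close>

type_synonym 'x inner_prod = "('x \<Rightarrow> real) \<Rightarrow> ('x \<Rightarrow> real) \<Rightarrow> real"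

definition fnorm :: "'x inner_prod \<Rightarrow> ('x \<Rightarrow> real) \<Rightarrow> real" where
  "fnorm ip f = sqrt (ip f f)"

definition fdist :: "'x inner_prod \<Rightarrow> ('x \<Rightarrow> real) \<Rightarrow> ('x \<Rightarrow> real) \<Rightarrow> real" where
  "fdist ip f g = fnorm ip (\<lambda>x. f x - g x)"

definition function_hilbert_space :: "('x \<Rightarrow> real) set \<Rightarrow> 'x inner_prod \<Rightarrow> bool" where
  "function_hilbert_space H ip \<longleftrightarrow>
     (\<lambda>x. 0) \<in> H \<and>
     (\<forall>f\<in>H. \<forall>g\<in>H. (\<lambda>x. f x + g x) \<in> H) \<and>
     (\<forall>c. \<forall>f\<in>H. (\<lambda>x. c * f x) \<in> H) \<and>
     (\<forall>f\<in>H. \<forall>g\<in>H. ip f g = ip g f) \<and>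
     (\<forall>f\<in>H. \<forall>g\<in>H. \<forall>h\<in>H. ip (\<lambda>x. f x + g x) h = ip f h + ip g h) \<and>
     (\<forall>c. \<forall>f\<in>H. \<forall>g\<in>H. ip (\<lambda>x. c * f x) g = c * ip f g) \<and>
     (\<forall>f\<in>H. ip f f \<ge> 0) \<and>
     (\<forall>f\<in>H. ip f f = 0 \<longrightarrow> f = (\<lambda>x. 0)) \<and>
     (\<forall>s. (\<forall>n::nat. s n \<in> H) \<and> (\<forall>e>0. \<exists>N. \<forall>m\<ge>N. \<forall>n\<ge>N. fdist ip (s m) (s n) < e)
        \<longrightarrow> (\<exists>f\<in>H. (\<lambda>n. fdist ip (s n) f) \<longlonglongrightarrow> 0))"

definition canonical_feature_map :: "('x \<Rightarrow> 'x \<Rightarrow> real) \<Rightarrow> 'x \<Rightarrow> ('x \<Rightarrow> real)" where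
  "canonical_feature_map K x = (\<lambda>y. K x y)"

text \<open>
  By the Moore--Aronszajn theorem, for a positive definite kernel \<open>K\<close> there is such an \<open>H\<close>, and \<open>H\<close>
  as well as the restriction of \<open>ip\<close> to \<open>H\<close> are unique.
\<close>

definition is_rkhs :: "('x \<Rightarrow> 'x \<Rightarrow> real) \<Rightarrow> ('x \<Rightarrow> real) set \<Rightarrow> 'x inner_prod \<Rightarrow> bool" where
  "is_rkhs K H ip \<longleftrightarrow>
     function_hilbert_space H ip \<and>
     (\<forall>x. canonical_feature_map K x \<in> H) \<and>
     (\<forall>f\<in>H. \<forall>x. f x = ip f (canonical_feature_map K x))"

definition is_feature_map ::
    "('x \<Rightarrow> real) set \<Rightarrow> 'x inner_prod \<Rightarrow> ('x \<Rightarrow> 'x \<Rightarrow> real) \<Rightarrow> ('x \<Rightarrow> ('x \<Rightarrow> real)) \<Rightarrow> bool" where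
  "is_feature_map H ip K \<Phi> \<longleftrightarrow> (\<forall>x. \<Phi> x \<in> H) \<and> (\<forall>x y. K x y = ip (\<Phi> x) (\<Phi> y))"


section \<open>Bochner integral with values in a Hilbert space of functions\<close>

text \<open>
  This follows \<^const>\<open>has_bochner_integral\<close>, with the type of values replaced by \<open>(H, ip)\<close>.
  Measurability of the integrand is expressed through the distances to the approximating simple
  functions.
\<close>

definition simple_integrable_into ::
    "('x \<Rightarrow> real) set \<Rightarrow> 'a measure \<Rightarrow> ('a \<Rightarrow> ('x \<Rightarrow> real)) \<Rightarrow> bool" where
  "simple_integrable_into H M s \<longleftrightarrow>
     simple_function M s \<and> s ` space M \<subseteq> H \<and>
     emeasure M {w\<in>space M. s w \<noteq> (\<lambda>x. 0)} < \<infinity>"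

definition simple_integral_into :: "'a measure \<Rightarrow> ('a \<Rightarrow> ('x \<Rightarrow> real)) \<Rightarrow> ('x \<Rightarrow> real)" where
  "simple_integral_into M s =
     (\<lambda>x. \<Sum>v\<in>s ` space M. measure M {w\<in>space M. s w = v} * v x)"

definition has_bochner_integral_into ::
    "('x \<Rightarrow> real) set \<Rightarrow> 'x inner_prod \<Rightarrow> 'a measure \<Rightarrow> ('a \<Rightarrow> ('x \<Rightarrow> real)) \<Rightarrow> ('x \<Rightarrow> real) \<Rightarrow> bool"
  where
  "has_bochner_integral_into H ip M f I \<longleftrightarrow>
     f ` space M \<subseteq> H \<and> I \<in> H \<and>
     (\<exists>s :: nat \<Rightarrow> 'a \<Rightarrow> ('x \<Rightarrow> real).
        (\<forall>i. simple_integrable_into H M (s i)) \<and>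
        (\<forall>i. (\<lambda>w. fdist ip (f w) (s i w)) \<in> borel_measurable M) \<and>
        (\<lambda>i. \<integral>\<^sup>+ w. ennreal (fdist ip (f w) (s i w)) \<partial>M) \<longlonglongrightarrow> 0 \<and>
        (\<lambda>i. fdist ip (simple_integral_into M (s i)) I) \<longlonglongrightarrow> 0)"

definition bochner_integrable_into ::
    "('x \<Rightarrow> real) set \<Rightarrow> 'x inner_prod \<Rightarrow> 'a measure \<Rightarrow> ('a \<Rightarrow> ('x \<Rightarrow> real)) \<Rightarrow> bool" where
  "bochner_integrable_into H ip M f \<longleftrightarrow> (\<exists>I. has_bochner_integral_into H ip M f I)"

definition bochner_integral_into ::
    "('x \<Rightarrow> real) set \<Rightarrow> 'x inner_prod \<Rightarrow> 'a measure \<Rightarrow> ('a \<Rightarrow> ('x \<Rightarrow> real)) \<Rightarrow> ('x \<Rightarrow> real)" where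
  "bochner_integral_into H ip M f = (THE I. has_bochner_integral_into H ip M f I)"

definition averaged_feature_map ::
    "('x \<Rightarrow> real) set \<Rightarrow> 'x inner_prod \<Rightarrow> 'g measure \<Rightarrow> ('g \<Rightarrow> 'x \<Rightarrow> 'x) \<Rightarrow>
     ('x \<Rightarrow> ('x \<Rightarrow> real)) \<Rightarrow> 'x \<Rightarrow> ('x \<Rightarrow> real)" where
  "averaged_feature_map H ip \<nu> \<phi> \<Phi> x = bochner_integral_into H ip \<nu> (\<lambda>g. \<Phi> (\<phi> g x))"

end

(* Continuity of the kernel yields simple maps approximating g -> phi_g x whose feature vectors
   converge in L1(nu), since the norm of the feature vector at x is at most a constant times rho(x).
   Completeness then gives the Bochner integral, which commutes with inner products; two
   applications of the reproducing property give the identity.  Positive definiteness is obtained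
   without the reproducing kernel Hilbert space: the averaged kernel is a pointwise limit of kernels
   whose quadratic forms are those of K at the finitely many values of the approximating maps. *)

theory Submission
  imports Defs
begin

text \<open>Positive definiteness of \<open>K\<^sub>\<nu>\<close> is claimed outside the quantifier
  over \<open>H\<close> and \<open>ip\<close>, and existence of a reproducing kernel Hilbert space
  is not established here, so that claim has to be argued with kernel values alone. What joins it to
  the Hilbert space part is that norms and distances of feature vectors are expressions in
  \<open>K\<close>, so a single approximation lemma serves both. The obstacle is that \<nu> may be
  infinite: a simple integrable function with values in \<open>H\<close> vanishes off a set of
  finite measure, whereas a simple map into the space of points need not take any value whose
  feature vector is zero. Hence every approximating map is paired with a set of finite measure
  outside which its feature vector is replaced by 0, and the error is measured against this
  truncated vector.\<close>

lemma nonneg_quadratic_imp_discriminant: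
  fixes a b c :: real
  assumes "\<And>t. 0 \<le> a * t\<^sup>2 + 2 * b * t + c"
  shows "b\<^sup>2 \<le> a * c"
proof (cases "a = 0")
  case True
  have "b = 0"
  proof (rule ccontr)
    assume "b \<noteq> 0"
    \<comment> \<open>With \<open>a = 0\<close> the function is affine, and at this argument its
      value is -1.\<close>
    with assms[of "- (c + 1) / (2 * b)"] True show False
      by simp
  qed
  with True show ?thesis by simp
next
  case False
  have "a > 0"
  proof (rule ccontr)
    assume "\<not> a > 0"
    with False have a: "a < 0" by simp
    \<comment> \<open>Large enough that \<open>a * t + 2 * b\<close> is at most
      \<open>- \<bar>c\<bar> - 1\<close>; the final summand 1 makes \<open>t \<ge> 1\<close>, so
      multiplying by \<open>t\<close> keeps this bound.\<close>
    define t where "t = (2 * \<bar>b\<bar> + \<bar>c\<bar> + 1) / (- a) + 1"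
    have t: "t \<ge> 1" using a by (simp add: t_def divide_nonneg_neg)
    have at: "a * t = - (2 * \<bar>b\<bar> + \<bar>c\<bar> + 1) + a"
      using a by (simp add: t_def field_simps)
    have "a * t\<^sup>2 + 2 * b * t + c = (a * t + 2 * b) * t + c"
      by (simp add: power2_eq_square algebra_simps)
    also have "\<dots> \<le> (- \<bar>c\<bar> - 1) * t + c"
      using t a by (intro add_right_mono mult_right_mono) (auto simp: at)
    also have "\<dots> \<le> (- \<bar>c\<bar> - 1) * 1 + c"
      using t by (intro add_right_mono mult_left_mono_neg) auto
    also have "\<dots> < 0" by simp
    finally show False using assms[of t] by simp
  qed
  \<comment> \<open>The parabola is evaluated at its vertex, where its value is
    \<open>c - b\<^sup>2 / a\<close>.\<close>
  then show ?thesis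
    using assms[of "- b / a"] by (simp add: field_simps power2_eq_square)
qed

section \<open>Positive definite kernels\<close>

lemma pos_def_kernel_sym: "pos_def_kernel K \<Longrightarrow> K x y = K y x"
  by (simp add: pos_def_kernel_def)

text \<open>Free choice of the index type pays off twice: small sets such as
  \<open>{True, False}\<close> give the Cauchy-Schwarz inequalities, and pairs of an index and a
  point give positive definiteness of the averaged kernel. As \<open>q\<close> need not be
  injective, points may be repeated.\<close>

lemma pos_def_kernel_sum_nonneg:
  fixes q :: "'i \<Rightarrow> 'x"
  assumes K: "pos_def_kernel K" and S: "finite S"
  shows "0 \<le> (\<Sum>s\<in>S. \<Sum>t\<in>S. c s * c t * K (q s) (q t))"
proof -
  obtain h where h: "bij_betw h {0..<card S} S"
    using ex_bij_betw_nat_finite[OF S] by blast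
  have "0 \<le> (\<Sum>i<card S. \<Sum>j<card S. c (h i) * c (h j) * K (q (h i)) (q (h j)))"
    using K by (auto simp: pos_def_kernel_def)
  also have "\<dots> = (\<Sum>s\<in>S. \<Sum>t\<in>S. c s * c t * K (q s) (q t))"
    using h by (subst (1 2) sum.reindex_bij_betw[OF h, symmetric]) (simp add: atLeast0LessThan)
  finally show ?thesis .
qed

lemma weighted_kernel_pos_def:
  assumes "pos_def_kernel k"
  shows "pos_def_kernel (weighted_kernel k \<rho>)"
  unfolding pos_def_kernel_def
proof (intro conjI allI)
  show "weighted_kernel k \<rho> x y = weighted_kernel k \<rho> y x" for x y
    using pos_def_kernel_sym[OF assms, of x y] by (simp add: weighted_kernel_def)
  fix n and p :: "nat \<Rightarrow> 'a" and a :: "nat \<Rightarrow> real"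
  show "0 \<le> (\<Sum>i<n. \<Sum>j<n. a i * a j * weighted_kernel k \<rho> (p i) (p j))"
    using pos_def_kernel_sum_nonneg[OF assms, of "{..<n}" "\<lambda>i. a i * \<rho> (p i)" p]
    by (simp add: weighted_kernel_def mult_ac)
qed

text \<open>This and \<open>kdist\<close> are the norm of a feature vector and the distance of two
  of them, written without a Hilbert space; \<open>fdist_feature_zero\<close> and
  \<open>fdist_feature\<close> confirm this once a Hilbert space is given.\<close>

definition knorm :: "('x \<Rightarrow> 'x \<Rightarrow> real) \<Rightarrow> 'x \<Rightarrow> real" where
  "knorm K x = sqrt (K x x)"

definition kdist :: "('x \<Rightarrow> 'x \<Rightarrow> real) \<Rightarrow> 'x \<Rightarrow> 'x \<Rightarrow> real" where
  "kdist K x y = sqrt (K x x - 2 * K x y + K y y)"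

lemma pos_def_kernel_diag: "pos_def_kernel K \<Longrightarrow> 0 \<le> K x x"
  using pos_def_kernel_sum_nonneg[of K "{()}" "\<lambda>_. 1" "\<lambda>_. x"] by simp

lemma pos_def_kernel_dist_sq: "pos_def_kernel K \<Longrightarrow> 0 \<le> K x x - 2 * K x y + K y y"
  using pos_def_kernel_sum_nonneg[of K "{True, False}" "\<lambda>b. if b then 1 else -1"
      "\<lambda>b. if b then x else y"] pos_def_kernel_sym[of K x y]
  by simp

lemma knorm_nonneg: "pos_def_kernel K \<Longrightarrow> 0 \<le> knorm K x"
  by (simp add: knorm_def pos_def_kernel_diag)

lemma kdist_nonneg: "pos_def_kernel K \<Longrightarrow> 0 \<le> kdist K x y"
  by (simp add: kdist_def pos_def_kernel_dist_sq)

lemma kernel_cauchy_schwarz: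
  assumes K: "pos_def_kernel K"
  shows "\<bar>K x y\<bar> \<le> knorm K x * knorm K y"
proof -
  have "(K x y)\<^sup>2 \<le> K x x * K y y"
  proof (rule nonneg_quadratic_imp_discriminant)
    fix t
    show "0 \<le> K x x * t\<^sup>2 + 2 * K x y * t + K y y"
      using pos_def_kernel_sum_nonneg[OF K, of "{True, False}" "\<lambda>b. if b then t else 1"
          "\<lambda>b. if b then x else y"] pos_def_kernel_sym[OF K, of x y]
      by (simp add: power2_eq_square algebra_simps)
  qed
  then have "sqrt ((K x y)\<^sup>2) \<le> sqrt (K x x * K y y)" by (rule real_sqrt_le_mono)
  then show ?thesis by (simp add: knorm_def real_sqrt_mult)
qed

text \<open>This is Cauchy-Schwarz for the difference of the feature vectors of \<open>x\<close> and
  \<open>y\<close> against that of \<open>z\<close>: the quadratic form of \<open>K\<close> at the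
  three points with coefficients \<open>t\<close>, \<open>- t\<close>, \<open>1\<close> is a
  nonnegative quadratic in \<open>t\<close>.\<close>

lemma kernel_diff_cauchy_schwarz:
  assumes K: "pos_def_kernel K"
  shows "\<bar>K x z - K y z\<bar> \<le> kdist K x y * knorm K z"
proof -
  have "(K x z - K y z)\<^sup>2 \<le> (K x x - 2 * K x y + K y y) * K z z"
  proof (rule nonneg_quadratic_imp_discriminant)
    fix t
    show "0 \<le> (K x x - 2 * K x y + K y y) * t\<^sup>2 + 2 * (K x z - K y z) * t + K z z"
      using pos_def_kernel_sum_nonneg[OF K, of "{0, 1, 2::nat}"
          "\<lambda>i. if i = 0 then t else if i = 1 then - t else 1"
          "\<lambda>i. if i = 0 then x else if i = 1 then y else z"]
        pos_def_kernel_sym[OF K, of x y] pos_def_kernel_sym[OF K, of x z]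
        pos_def_kernel_sym[OF K, of y z]
      by (simp add: power2_eq_square algebra_simps)
  qed
  then have "sqrt ((K x z - K y z)\<^sup>2) \<le> sqrt ((K x x - 2 * K x y + K y y) * K z z)"
    by (rule real_sqrt_le_mono)
  then show ?thesis by (simp add: kdist_def knorm_def real_sqrt_mult)
qed

lemma kdist_le:
  assumes K: "pos_def_kernel K"
  shows "kdist K x y \<le> knorm K x + knorm K y"
proof -
  have "K x x - 2 * K x y + K y y \<le> (knorm K x + knorm K y)\<^sup>2"
    using kernel_cauchy_schwarz[OF K, of x y] pos_def_kernel_diag[OF K]
    by (simp add: power2_sum knorm_def)
  then show ?thesis
    using knorm_nonneg[OF K] by (auto simp: kdist_def intro!: real_le_lsqrt add_nonneg_nonneg)
qed

text \<open>One argument is changed at a time, passing through \<open>K y z\<close>; symmetry brings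
  the second change into the first argument, so that \<open>kernel_diff_cauchy_schwarz\<close>
  covers both.\<close>

lemma kernel_diff_le:
  assumes K: "pos_def_kernel K"
  shows "\<bar>K x z - K y w\<bar> \<le> kdist K x y * knorm K z + knorm K y * kdist K z w"
proof -
  have "\<bar>K x z - K y w\<bar> \<le> \<bar>K x z - K y z\<bar> + \<bar>K z y - K w y\<bar>"
    using pos_def_kernel_sym[OF K, of y z] pos_def_kernel_sym[OF K, of y w] by linarith
  also have "\<dots> \<le> kdist K x y * knorm K z + kdist K z w * knorm K y"
    by (intro add_mono kernel_diff_cauchy_schwarz K)
  finally show ?thesis by (simp add: mult_ac)
qed

section \<open>Approximation by simple maps\<close>

lemma continuous_kernel_measurable:
  fixes K :: "'x::second_countable_topology \<Rightarrow> 'x \<Rightarrow> real"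
  assumes cont: "continuous_on UNIV (\<lambda>(x, y). K x y)"
    and f: "f \<in> borel_measurable M" and g: "g \<in> borel_measurable M"
  shows "(\<lambda>w. K (f w) (g w)) \<in> borel_measurable M"
proof -
  have "(\<lambda>w. (f w, g w)) \<in> borel_measurable M"
    using f g by (rule borel_measurable_Pair)
  from measurable_compose[OF this borel_measurable_continuous_onI[OF cont]]
  show ?thesis by simp
qed

lemma tendsto_kernel:
  fixes K :: "'x::topological_space \<Rightarrow> 'x \<Rightarrow> real"
  assumes cont: "continuous_on UNIV (\<lambda>(x, y). K x y)"
    and "(f \<longlongrightarrow> a) F" and "(g \<longlongrightarrow> b) F"
  shows "((\<lambda>w. K (f w) (g w)) \<longlongrightarrow> K a b) F"
  using continuous_on_tendsto_compose[OF cont tendsto_Pair[OF assms(2,3)]] by simp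

text \<open>The distance from the feature vector of \<open>y w\<close> to the truncated approximant,
  which is the feature vector of \<open>p w\<close> on \<open>A\<close> and 0 elsewhere.\<close>

definition approx_error ::
    "('x \<Rightarrow> 'x \<Rightarrow> real) \<Rightarrow> ('a \<Rightarrow> 'x) \<Rightarrow> ('a \<Rightarrow> 'x) \<Rightarrow> 'a set \<Rightarrow> 'a \<Rightarrow> real" where
  "approx_error K y p A w = (if w \<in> A then kdist K (y w) (p w) else knorm K (y w))"

text \<open>This encodes L1 approximation of feature vectors by simple ones. The norm bound on
  \<open>A m\<close> is recorded because double integrals involve products of an approximant in one
  variable with an error in the other. Any constant above 1 could replace 2: it must leave room for
  convergent norms to satisfy the bound eventually.\<close>

definition simple_approx ::
    "('x \<Rightarrow> 'x \<Rightarrow> real) \<Rightarrow> 'a measure \<Rightarrow> ('a \<Rightarrow> 'x) \<Rightarrow> (nat \<Rightarrow> 'a \<Rightarrow> 'x) \<Rightarrow> (nat \<Rightarrow> 'a set) \<Rightarrow> bool" where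
  "simple_approx K M y p A \<longleftrightarrow>
     (\<forall>m. simple_function M (p m)) \<and>
     (\<forall>m. A m \<in> sets M \<and> emeasure M (A m) < \<infinity>) \<and>
     (\<forall>m. \<forall>w\<in>A m. knorm K (p m w) \<le> 2 * knorm K (y w)) \<and>
     (\<forall>m. integrable M (approx_error K y (p m) (A m))) \<and>
     (\<lambda>m. \<integral>w. approx_error K y (p m) (A m) w \<partial>M) \<longlonglongrightarrow> 0"

lemma approx_error_nonneg: "pos_def_kernel K \<Longrightarrow> 0 \<le> approx_error K y p A w"
  by (simp add: approx_error_def kdist_nonneg knorm_nonneg)

text \<open>Measurability of \<open>y\<close> supplies simple maps converging pointwise, and
  continuity of \<open>K\<close> carries this over to \<open>kdist\<close>. Convergence of the
  integrals then follows by dominated convergence, for which the sets \<open>A m\<close> are cut to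
  size.\<close>

lemma simple_approx_exists:
  fixes K :: "'x::{metric_space, second_countable_topology} \<Rightarrow> 'x \<Rightarrow> real"
  assumes K: "pos_def_kernel K" and cont: "continuous_on UNIV (\<lambda>(x, y). K x y)"
    and y: "y \<in> borel_measurable M" and int: "integrable M (\<lambda>w. knorm K (y w))"
  shows "\<exists>p A. simple_approx K M y p A"
proof -
  \<comment> \<open>The instantiated point is the base point of a distance bound that the cited
    lemma also provides; the bound is dropped here, so any point will do.\<close>
  obtain p where p: "\<And>m. simple_function M (p m)"
    and lim: "\<And>w. w \<in> space M \<Longrightarrow> (\<lambda>m. p m w) \<longlonglongrightarrow> y w"
    using borel_measurable_implies_sequence_metric[OF y, of undefined] by blast
  have p_meas: "p m \<in> borel_measurable M" for m
    using p by (rule borel_measurable_simple_function)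
  have norm_meas: "(\<lambda>w. knorm K (f w)) \<in> borel_measurable M"
    if f: "f \<in> borel_measurable M" for f
    unfolding knorm_def using continuous_kernel_measurable[OF cont f f] by measurable
  have dist_meas: "(\<lambda>w. kdist K (y w) (p m w)) \<in> borel_measurable M" for m
    unfolding kdist_def
    using continuous_kernel_measurable[OF cont y y] continuous_kernel_measurable[OF cont y p_meas]
      continuous_kernel_measurable[OF cont p_meas p_meas] by measurable
  \<comment> \<open>The lower cut keeps the measure finite, by Markov's inequality, as \<open>p m\<close> has finitely many
    values; the upper cut provides domination.\<close>
  define A where
    "A m = {w\<in>space M. 0 < knorm K (p m w) \<and> knorm K (p m w) \<le> 2 * knorm K (y w)}" for m
  note [measurable] = norm_meas[OF y] norm_meas[OF p_meas] dist_meas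
  have A_sets [measurable]: "A m \<in> sets M" for m
    unfolding A_def by measurable
  have A_fin: "emeasure M (A m) < \<infinity>" for m
  proof -
    define V where "V = {r \<in> (\<lambda>w. knorm K (p m w)) ` space M. 0 < r}"
    \<comment> \<open>A positive lower bound for the nonzero norms taken by \<open>p m\<close>;
      inserting 1 keeps the minimum meaningful when \<open>V\<close> is empty.\<close>
    define c where "c = Min (insert 1 V)"
    have "finite (p m ` space M)"
      using p by (rule simple_functionD)
    then have "finite (knorm K ` p m ` space M)" by (rule finite_imageI)
    then have fin: "finite V"
      unfolding V_def image_image by simp
    have c: "0 < c"
      using fin by (auto simp: c_def V_def)
    have "A m \<subseteq> {w\<in>space M. c / 2 \<le> knorm K (y w)}"
    proof
      fix w assume w: "w \<in> A m"
      then have "knorm K (p m w) \<in> V" by (auto simp: A_def V_def)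
      then have "c \<le> knorm K (p m w)" using fin by (simp add: c_def)
      with w show "w \<in> {w\<in>space M. c / 2 \<le> knorm K (y w)}" by (auto simp: A_def)
    qed
    then have "emeasure M (A m) \<le> emeasure M {w\<in>space M. c / 2 \<le> knorm K (y w)}"
      by (intro emeasure_mono) measurable
    also have "\<dots> \<le> ennreal (1 / (c / 2) * (\<integral>w. knorm K (y w) \<partial>M))"
      using c by (intro integral_Markov_inequality int) (auto simp: knorm_nonneg[OF K])
    also have "\<dots> < \<infinity>" by simp
    finally show ?thesis .
  qed
  have e_meas: "approx_error K y (p m) (A m) \<in> borel_measurable M" for m
    unfolding approx_error_def[abs_def] by measurable
  \<comment> \<open>On \<open>A m\<close> the constant is 1 + 2, by the triangle inequality and the
    upper cut.\<close>
  have e_le: "norm (approx_error K y (p m) (A m) w) \<le> 3 * knorm K (y w)" for m w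
    using kdist_le[OF K, of "y w" "p m w"] knorm_nonneg[OF K, of "y w"]
      approx_error_nonneg[OF K, of y "p m" "A m" w]
    by (auto simp: approx_error_def A_def)
  have e_lim: "(\<lambda>m. approx_error K y (p m) (A m) w) \<longlonglongrightarrow> 0" if w: "w \<in> space M" for w
  proof (cases "knorm K (y w) = 0")
    case True
    then have "approx_error K y (p m) (A m) w = 0" for m
      using e_le[of m w] by simp
    then show ?thesis by simp
  next
    case False
    then have pos: "0 < knorm K (y w)"
      using knorm_nonneg[OF K, of "y w"] by simp
    have norm_lim: "(\<lambda>m. knorm K (p m w)) \<longlonglongrightarrow> knorm K (y w)"
      unfolding knorm_def by (intro tendsto_real_sqrt tendsto_kernel[OF cont] lim w)
    have "(\<lambda>m. kdist K (y w) (p m w)) \<longlonglongrightarrow>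
        sqrt (K (y w) (y w) - 2 * K (y w) (y w) + K (y w) (y w))"
      unfolding kdist_def
      by (intro tendsto_intros tendsto_kernel[OF cont] lim w)
    then have dist_lim: "(\<lambda>m. kdist K (y w) (p m w)) \<longlonglongrightarrow> 0" by simp
    \<comment> \<open>The limit of the norms is positive, hence strictly between 0 and twice itself;
      so \<open>w\<close> eventually stays in \<open>A m\<close>.\<close>
    have "\<forall>\<^sub>F m in sequentially. 0 < knorm K (p m w)"
      using norm_lim pos by (rule order_tendstoD)
    moreover have "\<forall>\<^sub>F m in sequentially. knorm K (p m w) < 2 * knorm K (y w)"
      using pos by (intro order_tendstoD(2)[OF norm_lim]) simp
    ultimately have "\<forall>\<^sub>F m in sequentially.
        kdist K (y w) (p m w) = approx_error K y (p m) (A m) w"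
      by eventually_elim (use w in \<open>simp add: approx_error_def A_def\<close>)
    with dist_lim show ?thesis by (rule Lim_transform_eventually)
  qed
  have bnd: "integrable M (\<lambda>w. 3 * knorm K (y w))" using int by simp
  have "integrable M (approx_error K y (p m) (A m))" for m
    using e_le[of m] by (intro Bochner_Integration.integrable_bound[OF bnd e_meas] AE_I2)
      (auto intro: order_trans[OF _ abs_ge_self])
  moreover have "(\<lambda>m. \<integral>w. approx_error K y (p m) (A m) w \<partial>M) \<longlonglongrightarrow> (\<integral>w. 0 \<partial>M)"
    by (rule integral_dominated_convergence[where w = "\<lambda>w. 3 * knorm K (y w)"])
      (use e_meas e_lim bnd e_le in auto)
  ultimately have "simple_approx K M y p A"
    unfolding simple_approx_def using p A_sets A_fin by (auto simp: A_def)
  then show ?thesis by blast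
qed

text \<open>On each fibre of \<open>p\<close> the integrand is a constant multiple of an indicator.
  An arbitrary \<open>F\<close> is allowed so that the result applies first to a kernel section and
  then to a finite sum of kernel values.\<close>

lemma integral_simple_on:
  fixes F :: "'x \<Rightarrow> real"
  assumes p: "simple_function M p" and A: "A \<in> sets M" "emeasure M A < \<infinity>"
  shows "integrable M (\<lambda>w. indicator A w * F (p w))"
    and "(\<integral>w. indicator A w * F (p w) \<partial>M) =
      (\<Sum>v\<in>p ` space M. measure M (A \<inter> (p -` {v} \<inter> space M)) * F v)"
proof -
  have fin: "finite (p ` space M)" and meas: "p -` {v} \<inter> space M \<in> sets M" for v
    using simple_functionD[OF p] by auto
  have fm: "emeasure M (A \<inter> (p -` {v} \<inter> space M)) < \<infinity>" for v
    using A(2) by (rule le_less_trans[OF emeasure_mono, rotated 2]) (use A in auto)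
  have eq: "indicator A w * F (p w) =
      (\<Sum>v\<in>p ` space M. indicator (A \<inter> (p -` {v} \<inter> space M)) w * F v)"
    if w: "w \<in> space M" for w
  proof -
    have "(\<Sum>v\<in>p ` space M. indicator (A \<inter> (p -` {v} \<inter> space M)) w * F v) =
        (\<Sum>v\<in>p ` space M. if v = p w then indicator A w * F (p w) else 0)"
      using w by (intro sum.cong) (auto simp: indicator_def)
    then show ?thesis using fin w by simp
  qed
  have int: "integrable M (\<lambda>w. indicator (A \<inter> (p -` {v} \<inter> space M)) w * F v)" for v
    using A meas fm by (intro integrable_mult_left integrable_real_indicator) auto
  have "integrable M (\<lambda>w. \<Sum>v\<in>p ` space M. indicator (A \<inter> (p -` {v} \<inter> space M)) w * F v)"
    using int by (rule Bochner_Integration.integrable_sum)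
  then show "integrable M (\<lambda>w. indicator A w * F (p w))"
    by (subst Bochner_Integration.integrable_cong[OF refl eq]) auto
  have "(\<integral>w. indicator A w * F (p w) \<partial>M) =
      (\<integral>w. (\<Sum>v\<in>p ` space M. indicator (A \<inter> (p -` {v} \<inter> space M)) w * F v) \<partial>M)"
    by (intro Bochner_Integration.integral_cong eq refl)
  also have "\<dots> = (\<Sum>v\<in>p ` space M. measure M (A \<inter> (p -` {v} \<inter> space M)) * F v)"
    using int by (simp add: Bochner_Integration.integral_sum Int_assoc)
  finally show "(\<integral>w. indicator A w * F (p w) \<partial>M) =
      (\<Sum>v\<in>p ` space M. measure M (A \<inter> (p -` {v} \<inter> space M)) * F v)" .
qed

text \<open>Replacing both arguments by truncated approximants costs at most a sum of two products,
  each separating \<open>g\<close> from \<open>h\<close>. Integrating in the given order therefore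
  turns the cost into products of integrals, each with a factor tending to 0, and the order of
  integration is never exchanged.\<close>

lemma approx_double_integral_tendsto:
  fixes y z :: "'a \<Rightarrow> 'x"
  assumes K: "pos_def_kernel K"
    and y: "simple_approx K M y p A" and z: "simple_approx K M z q C"
    and ny: "integrable M (\<lambda>w. knorm K (y w))" and nz: "integrable M (\<lambda>w. knorm K (z w))"
    and int1: "\<And>h. integrable M (\<lambda>g. K (y g) (z h))"
    and int2: "integrable M (\<lambda>h. \<integral>g. K (y g) (z h) \<partial>M)"
  shows "(\<lambda>m. \<Sum>v\<in>q m ` space M. \<Sum>u\<in>p m ` space M.
      measure M (C m \<inter> (q m -` {v} \<inter> space M)) * measure M (A m \<inter> (p m -` {u} \<inter> space M)) * K u v)
    \<longlonglongrightarrow> (\<integral>h. (\<integral>g. K (y g) (z h) \<partial>M) \<partial>M)"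
proof -
  define d where "d m = approx_error K y (p m) (A m)" for m
  define e where "e m = approx_error K z (q m) (C m)" for m
  define B where "B m h = (\<integral>g. indicator (A m) g * K (p m g) (q m h) \<partial>M)" for m h
  have p: "simple_function M (p m)" "A m \<in> sets M" "emeasure M (A m) < \<infinity>"
    and pn: "\<And>w. w \<in> A m \<Longrightarrow> knorm K (p m w) \<le> 2 * knorm K (y w)"
    and d: "integrable M (d m)" and dlim: "(\<lambda>m. \<integral>w. d m w \<partial>M) \<longlonglongrightarrow> 0" for m
    using y by (auto simp: simple_approx_def d_def)
  have q: "simple_function M (q m)" "C m \<in> sets M" "emeasure M (C m) < \<infinity>"
    and e: "integrable M (e m)" and elim: "(\<lambda>m. \<integral>w. e m w \<partial>M) \<longlonglongrightarrow> 0" for m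
    using z by (auto simp: simple_approx_def e_def)
  have d0: "0 \<le> d m w" and e0: "0 \<le> e m w" for m w
    by (simp_all add: d_def e_def approx_error_nonneg[OF K])
  have B_eq: "B m h = (\<Sum>u\<in>p m ` space M. measure M (A m \<inter> (p m -` {u} \<inter> space M)) * K u (q m h))"
    for m h
    unfolding B_def using p by (rule integral_simple_on)
  \<comment> \<open>By \<open>B_eq\<close>, \<open>B m h\<close> depends on \<open>h\<close> only
    through \<open>q m h\<close>, so \<open>integral_simple_on\<close> applies a second
    time.\<close>
  have B_int: "integrable M (\<lambda>h. indicator (C m) h * B m h)" for m
    unfolding B_eq by (rule integral_simple_on[OF q])
  have BB: "(\<integral>h. indicator (C m) h * B m h \<partial>M) =
      (\<Sum>v\<in>q m ` space M. \<Sum>u\<in>p m ` space M.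
      measure M (C m \<inter> (q m -` {v} \<inter> space M)) * measure M (A m \<inter> (p m -` {u} \<inter> space M)) * K u v)"
    for m
    unfolding B_eq by (subst integral_simple_on(2)[OF q]) (simp add: sum_distrib_left mult_ac)
  \<comment> \<open>If \<open>g\<close> or \<open>h\<close> is outside its set, the approximant is 0
    and one error equals a full norm, so Cauchy-Schwarz for \<open>K\<close> suffices. The factor 2
    is the norm bound for \<open>p m\<close> on \<open>A m\<close>.\<close>
  have pointwise: "\<bar>K (y g) (z h) - indicator (C m) h * (indicator (A m) g * K (p m g) (q m h))\<bar>
      \<le> d m g * knorm K (z h) + 2 * knorm K (y g) * e m h" for m g h
  proof (cases "g \<in> A m \<and> h \<in> C m")
    case True
    have "\<bar>K (y g) (z h) - K (p m g) (q m h)\<bar>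
        \<le> kdist K (y g) (p m g) * knorm K (z h) + knorm K (p m g) * kdist K (z h) (q m h)"
      by (rule kernel_diff_le[OF K])
    also have "\<dots> \<le> kdist K (y g) (p m g) * knorm K (z h) + 2 * knorm K (y g) * kdist K (z h) (q m h)"
      using pn True by (intro add_left_mono mult_right_mono kdist_nonneg[OF K]) auto
    finally show ?thesis using True by (simp add: d_def e_def approx_error_def)
  next
    case False
    have "\<bar>K (y g) (z h)\<bar> \<le> d m g * knorm K (z h) + 2 * knorm K (y g) * e m h"
    proof (cases "g \<in> A m")
      case True
      with False have "e m h = knorm K (z h)" by (simp add: e_def approx_error_def)
      moreover have "0 \<le> d m g * knorm K (z h)" "0 \<le> knorm K (y g) * knorm K (z h)"
        by (simp_all add: d0 knorm_nonneg[OF K])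
      ultimately show ?thesis
        using kernel_cauchy_schwarz[OF K, of "y g" "z h"] by simp
    next
      case False
      then have "d m g = knorm K (y g)" by (simp add: d_def approx_error_def)
      moreover have "0 \<le> 2 * knorm K (y g) * e m h"
        by (simp add: e0 knorm_nonneg[OF K])
      ultimately show ?thesis
        using kernel_cauchy_schwarz[OF K, of "y g" "z h"] by (smt (verit))
    qed
    with False show ?thesis by auto
  qed
  have inner: "\<bar>(\<integral>g. K (y g) (z h) \<partial>M) - indicator (C m) h * B m h\<bar>
      \<le> (\<integral>g. d m g \<partial>M) * knorm K (z h) + 2 * (\<integral>g. knorm K (y g) \<partial>M) * e m h" for m h
  proof -
    have i: "integrable M (\<lambda>g. indicator (C m) h * (indicator (A m) g * K (p m g) (q m h)))"
      by (intro integrable_mult_right integral_simple_on[OF p])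
    have "(\<integral>g. K (y g) (z h) \<partial>M) - indicator (C m) h * B m h =
        (\<integral>g. K (y g) (z h) - indicator (C m) h * (indicator (A m) g * K (p m g) (q m h)) \<partial>M)"
      unfolding B_def using int1 i by simp
    also have "\<bar>\<dots>\<bar> \<le> (\<integral>g. \<bar>K (y g) (z h) - indicator (C m) h * (indicator (A m) g * K (p m g) (q m h))\<bar> \<partial>M)"
      by (rule integral_abs_bound)
    also have "\<dots> \<le> (\<integral>g. d m g * knorm K (z h) + 2 * knorm K (y g) * e m h \<partial>M)"
      by (rule integral_mono)
        (intro pointwise integrable_abs Bochner_Integration.integrable_diff int1 i
          Bochner_Integration.integrable_add integrable_mult_left integrable_mult_right d ny)+
    also have "\<dots> = (\<integral>g. d m g \<partial>M) * knorm K (z h) + 2 * (\<integral>g. knorm K (y g) \<partial>M) * e m h"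
      using d ny by simp
    finally show ?thesis .
  qed
  have outer: "\<bar>(\<integral>h. indicator (C m) h * B m h \<partial>M) - (\<integral>h. (\<integral>g. K (y g) (z h) \<partial>M) \<partial>M)\<bar>
      \<le> (\<integral>g. d m g \<partial>M) * (\<integral>h. knorm K (z h) \<partial>M) + 2 * (\<integral>g. knorm K (y g) \<partial>M) * (\<integral>h. e m h \<partial>M)" for m
  proof -
    have "\<bar>(\<integral>h. indicator (C m) h * B m h \<partial>M) - (\<integral>h. (\<integral>g. K (y g) (z h) \<partial>M) \<partial>M)\<bar>
        = \<bar>\<integral>h. (\<integral>g. K (y g) (z h) \<partial>M) - indicator (C m) h * B m h \<partial>M\<bar>"
      using int2 B_int by simp
    also have "\<dots> \<le> (\<integral>h. \<bar>(\<integral>g. K (y g) (z h) \<partial>M) - indicator (C m) h * B m h\<bar> \<partial>M)"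
      by (rule integral_abs_bound)
    also have "\<dots> \<le> (\<integral>h. (\<integral>g. d m g \<partial>M) * knorm K (z h) + 2 * (\<integral>g. knorm K (y g) \<partial>M) * e m h \<partial>M)"
      by (rule integral_mono)
        (intro inner integrable_abs Bochner_Integration.integrable_diff int2 B_int
          Bochner_Integration.integrable_add integrable_mult_right e nz)+
    also have "\<dots> = (\<integral>g. d m g \<partial>M) * (\<integral>h. knorm K (z h) \<partial>M) + 2 * (\<integral>g. knorm K (y g) \<partial>M) * (\<integral>h. e m h \<partial>M)"
      using e nz by simp
    finally show ?thesis .
  qed
  have "(\<lambda>m. (\<integral>g. d m g \<partial>M) * (\<integral>h. knorm K (z h) \<partial>M) + 2 * (\<integral>g. knorm K (y g) \<partial>M) * (\<integral>h. e m h \<partial>M))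
      \<longlonglongrightarrow> 0 * (\<integral>h. knorm K (z h) \<partial>M) + 2 * (\<integral>g. knorm K (y g) \<partial>M) * 0"
    by (intro tendsto_intros dlim elim)
  then have lim0: "(\<lambda>m. (\<integral>g. d m g \<partial>M) * (\<integral>h. knorm K (z h) \<partial>M) + 2 * (\<integral>g. knorm K (y g) \<partial>M) * (\<integral>h. e m h \<partial>M)) \<longlonglongrightarrow> 0"
    by simp
  have "(\<lambda>m. (\<integral>h. indicator (C m) h * B m h \<partial>M) - (\<integral>h. (\<integral>g. K (y g) (z h) \<partial>M) \<partial>M)) \<longlonglongrightarrow> 0"
    by (rule Lim_null_comparison[OF _ lim0]) (use outer in \<open>simp add: always_eventually\<close>)
  then have "(\<lambda>m. \<integral>h. indicator (C m) h * B m h \<partial>M) \<longlonglongrightarrow> (\<integral>h. (\<integral>g. K (y g) (z h) \<partial>M) \<partial>M)"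
    by (subst LIM_zero_iff[symmetric])
  then show ?thesis by (simp only: BB)
qed

lemma averaged_kernel_pos_def:
  fixes \<phi> :: "'g \<Rightarrow> 'x::{metric_space, second_countable_topology} \<Rightarrow> 'x"
  assumes K: "pos_def_kernel K" and cont: "continuous_on UNIV (\<lambda>(x, y). K x y)"
    and meas: "\<And>x. (\<lambda>g. \<phi> g x) \<in> borel_measurable M"
    and norm_int: "\<And>x. integrable M (\<lambda>g. knorm K (\<phi> g x))"
    and int1: "\<And>x y h. integrable M (\<lambda>g. K (\<phi> g x) (\<phi> h y))"
    and int2: "\<And>x y. integrable M (\<lambda>h. \<integral>g. K (\<phi> g x) (\<phi> h y) \<partial>M)"
  shows "pos_def_kernel (averaged_kernel M \<phi> K)"
proof -
  obtain p A where pA: "\<And>x. simple_approx K M (\<lambda>g. \<phi> g x) (p x) (A x)"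
    using simple_approx_exists[OF K cont meas norm_int] by metis
  define R where "R x m = p x m ` space M" for x m
  define \<mu> where "\<mu> x m v = measure M (A x m \<inter> (p x m -` {v} \<inter> space M))" for x m v
  have lim: "(\<lambda>m. \<Sum>v\<in>R y m. \<Sum>u\<in>R x m. \<mu> y m v * \<mu> x m u * K u v) \<longlonglongrightarrow> averaged_kernel M \<phi> K x y"
    for x y
    unfolding averaged_kernel_def R_def \<mu>_def
    by (rule approx_double_integral_tendsto[OF K pA pA norm_int norm_int int1 int2])
  show ?thesis
    unfolding pos_def_kernel_def
  proof (intro conjI allI)
    fix x y
    \<comment> \<open>Symmetry is read off the finite sums, where exchanging the order is
      elementary, and passes to the limit.\<close>
    have "(\<lambda>m. \<Sum>v\<in>R y m. \<Sum>u\<in>R x m. \<mu> y m v * \<mu> x m u * K u v) =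
        (\<lambda>m. \<Sum>v\<in>R x m. \<Sum>u\<in>R y m. \<mu> x m v * \<mu> y m u * K u v)"
      by (subst sum.swap) (simp add: mult_ac pos_def_kernel_sym[OF K])
    then show "averaged_kernel M \<phi> K x y = averaged_kernel M \<phi> K y x"
      using LIMSEQ_unique[OF lim[of y x] ] lim[of x y] by simp
  next
    fix n :: nat and x :: "nat \<Rightarrow> 'x" and a :: "nat \<Rightarrow> real"
    have "(\<lambda>m. \<Sum>i<n. \<Sum>j<n. a i * a j * (\<Sum>v\<in>R (x j) m. \<Sum>u\<in>R (x i) m. \<mu> (x j) m v * \<mu> (x i) m u * K u v))
        \<longlonglongrightarrow> (\<Sum>i<n. \<Sum>j<n. a i * a j * averaged_kernel M \<phi> K (x i) (x j))"
      by (intro tendsto_intros lim)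
    moreover have "0 \<le> (\<Sum>i<n. \<Sum>j<n. a i * a j *
        (\<Sum>v\<in>R (x j) m. \<Sum>u\<in>R (x i) m. \<mu> (x j) m v * \<mu> (x i) m u * K u v))" for m
    proof -
      have fin: "finite (R (x i) m)" for i
        using pA by (auto simp: R_def simple_approx_def intro: simple_functionD)
      \<comment> \<open>The index \<open>i\<close> is kept in the pair because the same point may be
        a value of the approximating maps for several \<open>i\<close>, with different
        weights.\<close>
      define S where "S = Sigma {..<n} (\<lambda>i. R (x i) m)"
      define c where "c s = a (fst s) * \<mu> (x (fst s)) m (snd s)" for s
      have sum_S: "(\<Sum>s\<in>S. f s) = (\<Sum>i<n. \<Sum>u\<in>R (x i) m. f (i, u))" for f :: "nat \<times> 'x \<Rightarrow> real"
        unfolding S_def using fin by (simp add: sum.Sigma)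
      have "(\<Sum>s\<in>S. \<Sum>t\<in>S. c s * c t * K (snd s) (snd t)) =
          (\<Sum>i<n. \<Sum>u\<in>R (x i) m. \<Sum>j<n. \<Sum>v\<in>R (x j) m. c (i, u) * c (j, v) * K u v)"
        by (simp add: sum_S)
      also have "\<dots> = (\<Sum>i<n. \<Sum>j<n. \<Sum>u\<in>R (x i) m. \<Sum>v\<in>R (x j) m. c (i, u) * c (j, v) * K u v)"
        by (intro sum.cong refl sum.swap)
      also have "\<dots> = (\<Sum>i<n. \<Sum>j<n. \<Sum>v\<in>R (x j) m. \<Sum>u\<in>R (x i) m. c (i, u) * c (j, v) * K u v)"
        by (intro sum.cong refl sum.swap)
      also have "\<dots> = (\<Sum>i<n. \<Sum>j<n. a i * a j *
          (\<Sum>v\<in>R (x j) m. \<Sum>u\<in>R (x i) m. \<mu> (x j) m v * \<mu> (x i) m u * K u v))"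
        by (simp add: c_def sum_distrib_left mult_ac)
      finally show ?thesis
        using pos_def_kernel_sum_nonneg[OF K, of S c snd] fin by (simp add: S_def)
    qed
    ultimately show "0 \<le> (\<Sum>i<n. \<Sum>j<n. a i * a j * averaged_kernel M \<phi> K (x i) (x j))"
      by (intro LIMSEQ_le_const) auto
  qed
qed

section \<open>Bochner integrals in a Hilbert space of functions\<close>

locale function_hilbert =
  fixes H :: "('x \<Rightarrow> real) set" and ip :: "'x inner_prod"
  assumes function_hilbert_space: "function_hilbert_space H ip"
begin

lemma zero_mem: "(\<lambda>x. 0) \<in> H"
  and add_mem: "f \<in> H \<Longrightarrow> g \<in> H \<Longrightarrow> (\<lambda>x. f x + g x) \<in> H"
  and scale_mem: "f \<in> H \<Longrightarrow> (\<lambda>x. c * f x) \<in> H"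
  and ip_sym: "f \<in> H \<Longrightarrow> g \<in> H \<Longrightarrow> ip f g = ip g f"
  and ip_add: "f \<in> H \<Longrightarrow> g \<in> H \<Longrightarrow> h \<in> H \<Longrightarrow> ip (\<lambda>x. f x + g x) h = ip f h + ip g h"
  and ip_scale: "f \<in> H \<Longrightarrow> g \<in> H \<Longrightarrow> ip (\<lambda>x. c * f x) g = c * ip f g"
  and ip_nonneg: "f \<in> H \<Longrightarrow> 0 \<le> ip f f"
  and ip_definite: "f \<in> H \<Longrightarrow> ip f f = 0 \<Longrightarrow> f = (\<lambda>x. 0)"
  using function_hilbert_space unfolding function_hilbert_space_def by blast+

lemma cauchy_convergent:
  assumes "\<And>n. s n \<in> H" "\<And>e. 0 < e \<Longrightarrow> \<exists>N. \<forall>m\<ge>N. \<forall>n\<ge>N. fdist ip (s m) (s n) < e"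
  shows "\<exists>f\<in>H. (\<lambda>n::nat. fdist ip (s n) f) \<longlonglongrightarrow> 0"
  using function_hilbert_space assms unfolding function_hilbert_space_def by blast

lemma diff_mem: "f \<in> H \<Longrightarrow> g \<in> H \<Longrightarrow> (\<lambda>x. f x - g x) \<in> H"
  using add_mem[of f "\<lambda>x. -1 * g x"] scale_mem[of g "-1"] by simp

lemma ip_diff:
  "f \<in> H \<Longrightarrow> g \<in> H \<Longrightarrow> h \<in> H \<Longrightarrow> ip (\<lambda>x. f x - g x) h = ip f h - ip g h"
  using ip_add[of f "\<lambda>x. -1 * g x" h] scale_mem[of g "-1"] ip_scale[of g h "-1"] by simp

lemma ip_zero: "h \<in> H \<Longrightarrow> ip (\<lambda>x. 0) h = 0"
  using ip_scale[of h h 0] by simp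

lemma sum_mem: "(\<And>i. i \<in> S \<Longrightarrow> f i \<in> H) \<Longrightarrow> (\<lambda>x. \<Sum>i\<in>S. c i * f i x) \<in> H"
  by (induction S rule: infinite_finite_induct) (auto simp: zero_mem intro!: add_mem scale_mem)

lemma ip_sum:
  assumes "\<And>i. i \<in> S \<Longrightarrow> f i \<in> H" "h \<in> H"
  shows "ip (\<lambda>x. \<Sum>i\<in>S. c i * f i x) h = (\<Sum>i\<in>S. c i * ip (f i) h)"
  using assms(1)
proof (induction S rule: infinite_finite_induct)
  case (insert i S)
  then show ?case
    using assms(2) by (simp add: ip_add ip_scale scale_mem sum_mem)
qed (simp_all add: ip_zero assms(2))

lemma fnorm_nonneg: "f \<in> H \<Longrightarrow> 0 \<le> fnorm ip f"
  by (simp add: fnorm_def ip_nonneg)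

lemma fnorm_sq: "f \<in> H \<Longrightarrow> (fnorm ip f)\<^sup>2 = ip f f"
  by (simp add: fnorm_def ip_nonneg)

lemma fdist_nonneg: "f \<in> H \<Longrightarrow> g \<in> H \<Longrightarrow> 0 \<le> fdist ip f g"
  by (simp add: fdist_def fnorm_nonneg diff_mem)

lemma ip_diff_diff:
  assumes "f \<in> H" "g \<in> H"
  shows "ip (\<lambda>x. f x - g x) (\<lambda>x. f x - g x) = ip f f - 2 * ip f g + ip g g"
  using assms diff_mem[OF assms]
  by (simp add: ip_diff ip_sym[of _ "\<lambda>x. f x - g x"]) (simp add: ip_sym[of g f])

lemma cauchy_schwarz:
  assumes f: "f \<in> H" and g: "g \<in> H"
  shows "\<bar>ip f g\<bar> \<le> fnorm ip f * fnorm ip g"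
proof -
  have "(ip f g)\<^sup>2 \<le> ip f f * ip g g"
  proof (rule nonneg_quadratic_imp_discriminant)
    fix t
    \<comment> \<open>The vector \<open>g + t f\<close> is treated as the difference of
      \<open>g\<close> and \<open>- t f\<close>, to make \<open>ip_diff_diff\<close>
      applicable.\<close>
    have tf: "(\<lambda>x. - t * f x) \<in> H" using f by (rule scale_mem)
    have "ip (\<lambda>x. g x - (- t * f x)) (\<lambda>x. g x - (- t * f x)) = ip f f * t\<^sup>2 + 2 * ip f g * t + ip g g"
      using f g tf ip_scale[OF f tf, of "- t"] ip_scale[OF f g, of "- t"] ip_scale[OF f f, of "- t"]
      by (subst ip_diff_diff)
        (simp_all add: ip_sym[of g "\<lambda>x. - (t * f x)"] ip_sym[of f "\<lambda>x. - (t * f x)"]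
          power2_eq_square)
    moreover have "0 \<le> ip (\<lambda>x. g x - (- t * f x)) (\<lambda>x. g x - (- t * f x))"
      using g tf by (intro ip_nonneg diff_mem)
    ultimately show "0 \<le> ip f f * t\<^sup>2 + 2 * ip f g * t + ip g g" by simp
  qed
  then have "sqrt ((ip f g)\<^sup>2) \<le> sqrt (ip f f * ip g g)" by (rule real_sqrt_le_mono)
  then show ?thesis by (simp add: fnorm_def real_sqrt_mult)
qed

lemma ip_diff_le:
  "f \<in> H \<Longrightarrow> g \<in> H \<Longrightarrow> u \<in> H \<Longrightarrow> \<bar>ip f u - ip g u\<bar> \<le> fdist ip f g * fnorm ip u"
  using cauchy_schwarz[of "\<lambda>x. f x - g x" u] by (simp add: diff_mem ip_diff fdist_def)

lemma simple_integral_mem: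
  "simple_integrable_into H M s \<Longrightarrow> simple_integral_into M s \<in> H"
  unfolding simple_integral_into_def simple_integrable_into_def
  by (intro sum_mem) auto

lemma ip_simple_integral:
  assumes s: "simple_integrable_into H M s" and u: "u \<in> H"
  shows "integrable M (\<lambda>w. ip (s w) u)"
    and "(\<integral>w. ip (s w) u \<partial>M) = ip (simple_integral_into M s) u"
proof -
  have sf: "simple_function M s" and sH: "s ` space M \<subseteq> H"
    and fin: "emeasure M {w\<in>space M. s w \<noteq> (\<lambda>x. 0)} < \<infinity>"
    using s by (auto simp: simple_integrable_into_def)
  have sets: "{w\<in>space M. s w \<noteq> (\<lambda>x. 0)} \<in> sets M"
    using simple_functionD(2)[OF sf, of "- {\<lambda>x. 0}"] by (simp add: vimage_def Int_def conj_commute)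
  have "simple_function M (\<lambda>w. ip (s w) u)"
    using simple_function_compose[OF sf, of "\<lambda>f. ip f u"] by (simp add: comp_def)
  moreover have "emeasure M {w\<in>space M. ip (s w) u \<noteq> 0} \<le> emeasure M {w\<in>space M. s w \<noteq> (\<lambda>x. 0)}"
    using sets by (intro emeasure_mono) (auto simp: ip_zero u)
  ultimately have sb: "Bochner_Integration.simple_bochner_integrable M (\<lambda>w. ip (s w) u)"
    using fin by (auto intro!: simple_bochner_integrable.intros)
  show "integrable M (\<lambda>w. ip (s w) u)"
    using has_bochner_integral_simple_bochner_integrable[OF sb] by (auto simp: integrable.simps)
  have "(\<integral>w. ip (s w) u \<partial>M) = Bochner_Integration.simple_bochner_integral M (\<lambda>w. ip (s w) u)"
    using simple_bochner_integrable_eq_integral[OF sb] by simp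
  \<comment> \<open>The scalar integral is grouped by values of \<open>ip (s w) u\<close>; here it
    is regrouped by the finer partition into values of \<open>s\<close>.\<close>
  also have "\<dots> = (\<Sum>v\<in>s ` space M. measure M {w\<in>space M. s w = v} *\<^sub>R ip v u)"
    by (rule simple_bochner_integral_partition[OF sb sf]) auto
  also have "\<dots> = ip (simple_integral_into M s) u"
    unfolding simple_integral_into_def using sH u by (subst ip_sum) auto
  finally show "(\<integral>w. ip (s w) u \<partial>M) = ip (simple_integral_into M s) u" .
qed

text \<open>Both sides are limits of the inner products of \<open>u\<close> with the simple
  integrals, since pairing with \<open>u\<close> enlarges an error by at most the factor
  \<open>fnorm ip u\<close>. Measurability of the scalar integrand is a separate hypothesis, as
  \<open>has_bochner_integral_into\<close> speaks only of distances to simple functions.\<close>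

lemma ip_bochner_integral:
  assumes I: "has_bochner_integral_into H ip M f I" and u: "u \<in> H"
    and meas: "(\<lambda>w. ip (f w) u) \<in> borel_measurable M"
  shows "ip I u = (\<integral>w. ip (f w) u \<partial>M)"
proof -
  obtain s where fH: "\<And>w. w \<in> space M \<Longrightarrow> f w \<in> H" and IH: "I \<in> H"
    and s: "\<And>i::nat. simple_integrable_into H M (s i)"
    and dm: "\<And>i. (\<lambda>w. fdist ip (f w) (s i w)) \<in> borel_measurable M"
    and lim0: "(\<lambda>i. \<integral>\<^sup>+ w. ennreal (fdist ip (f w) (s i w)) \<partial>M) \<longlonglongrightarrow> 0"
    and limI: "(\<lambda>i. fdist ip (simple_integral_into M (s i)) I) \<longlonglongrightarrow> 0"
    using I by (auto simp: has_bochner_integral_into_def)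
  have sH: "w \<in> space M \<Longrightarrow> s i w \<in> H" for w i
    using s[of i] by (auto simp: simple_integrable_into_def)
  have d0: "w \<in> space M \<Longrightarrow> 0 \<le> fdist ip (f w) (s i w)" for w i
    by (intro fdist_nonneg fH sH)
  have nn: "(\<integral>\<^sup>+ w. ennreal (fdist ip (f w) (s i w)) \<partial>M) = ennreal (\<integral>w. fdist ip (f w) (s i w) \<partial>M)"
    if "integrable M (\<lambda>w. fdist ip (f w) (s i w))" for i
    using that by (intro nn_integral_eq_integral) (auto simp: d0)
  \<comment> \<open>Finitely many of these integrals may be infinite, so real-valued integrals are
    available only eventually.\<close>
  have "\<forall>\<^sub>F i in sequentially. (\<integral>\<^sup>+ w. ennreal (fdist ip (f w) (s i w)) \<partial>M) < 1"
    using lim0 by (rule order_tendstoD) simp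
  then have ev: "\<forall>\<^sub>F i in sequentially. integrable M (\<lambda>w. fdist ip (f w) (s i w))"
  proof eventually_elim
    case (elim i)
    then have "(\<integral>\<^sup>+ w. ennreal (fdist ip (f w) (s i w)) \<partial>M) < \<infinity>"
      using less_trans[of _ 1 "\<infinity> :: ennreal"] by simp
    then show ?case
      using dm by (intro integrableI_nonneg) (auto simp: d0)
  qed
  have "(\<lambda>i. enn2real (\<integral>\<^sup>+ w. ennreal (fdist ip (f w) (s i w)) \<partial>M)) \<longlonglongrightarrow> enn2real 0"
    using lim0 by (intro tendsto_enn2real) simp_all
  then have "(\<lambda>i. enn2real (\<integral>\<^sup>+ w. ennreal (fdist ip (f w) (s i w)) \<partial>M) * fnorm ip u) \<longlonglongrightarrow> 0"
    by (simp add: tendsto_mult_left_zero)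
  moreover have "\<forall>\<^sub>F i in sequentially. norm (ip (simple_integral_into M (s i)) u - (\<integral>w. ip (f w) u \<partial>M))
      \<le> enn2real (\<integral>\<^sup>+ w. ennreal (fdist ip (f w) (s i w)) \<partial>M) * fnorm ip u"
    using ev
  proof eventually_elim
    case (elim i)
    have le: "w \<in> space M \<Longrightarrow> \<bar>ip (s i w) u - ip (f w) u\<bar> \<le> fdist ip (f w) (s i w) * fnorm ip u" for w
      using ip_diff_le[OF fH sH u] by (simp add: abs_minus_commute)
    have si: "integrable M (\<lambda>w. ip (s i w) u)"
      using s u by (rule ip_simple_integral)
    have di: "integrable M (\<lambda>w. ip (s i w) u - ip (f w) u)"
      using elim le meas si
      by (intro Bochner_Integration.integrable_bound[OF integrable_mult_left[OF elim, of "fnorm ip u"]])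
        (auto intro!: AE_I2 intro: order_trans[OF _ abs_ge_self])
    have fi: "integrable M (\<lambda>w. ip (f w) u)"
      using Bochner_Integration.integrable_diff[OF si di] by simp
    have "\<bar>ip (simple_integral_into M (s i)) u - (\<integral>w. ip (f w) u \<partial>M)\<bar> = \<bar>\<integral>w. ip (s i w) u - ip (f w) u \<partial>M\<bar>"
      using si fi by (simp add: ip_simple_integral(2)[OF s u])
    also have "\<dots> \<le> (\<integral>w. \<bar>ip (s i w) u - ip (f w) u\<bar> \<partial>M)"
      by (rule integral_abs_bound)
    also have "\<dots> \<le> (\<integral>w. fdist ip (f w) (s i w) * fnorm ip u \<partial>M)"
      using di elim by (intro integral_mono le) auto
    also have "\<dots> = enn2real (\<integral>\<^sup>+ w. ennreal (fdist ip (f w) (s i w)) \<partial>M) * fnorm ip u"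
      using elim by (simp add: nn Bochner_Integration.integral_nonneg d0)
    finally show ?case by simp
  qed
  ultimately have "(\<lambda>i. ip (simple_integral_into M (s i)) u - (\<integral>w. ip (f w) u \<partial>M)) \<longlonglongrightarrow> 0"
    by (rule Lim_null_comparison[rotated])
  then have "(\<lambda>i. ip (simple_integral_into M (s i)) u) \<longlonglongrightarrow> (\<integral>w. ip (f w) u \<partial>M)"
    by (subst LIM_zero_iff[symmetric])
  moreover have "(\<lambda>i. ip (simple_integral_into M (s i)) u) \<longlonglongrightarrow> ip I u"
  proof -
    have "(\<lambda>i. fdist ip (simple_integral_into M (s i)) I * fnorm ip u) \<longlonglongrightarrow> 0"
      using limI by (simp add: tendsto_mult_left_zero)
    then have "(\<lambda>i. ip (simple_integral_into M (s i)) u - ip I u) \<longlonglongrightarrow> 0"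
      by (rule Lim_null_comparison[rotated])
        (auto intro!: always_eventually ip_diff_le simple_integral_mem s IH u)
    then show ?thesis by (subst LIM_zero_iff[symmetric])
  qed
  ultimately show ?thesis by (rule LIMSEQ_unique[rotated])
qed

text \<open>This gives the definite description its meaning: two candidates have equal inner
  products with every \<open>u\<close>, in particular with their own difference, which must then be
  0.\<close>

lemma bochner_integral_into_eq:
  assumes I: "has_bochner_integral_into H ip M f I"
    and meas: "\<And>u. u \<in> H \<Longrightarrow> (\<lambda>w. ip (f w) u) \<in> borel_measurable M"
  shows "bochner_integral_into H ip M f = I"
  unfolding bochner_integral_into_def
proof (rule the_equality)
  fix J assume J: "has_bochner_integral_into H ip M f J"
  have IH: "I \<in> H" and JH: "J \<in> H"
    using I J by (auto simp: has_bochner_integral_into_def)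
  have "ip (\<lambda>x. J x - I x) u = 0" if "u \<in> H" for u
    using that by (simp add: ip_diff IH JH ip_bochner_integral[OF I that meas]
        ip_bochner_integral[OF J that meas])
  then have "(\<lambda>x. J x - I x) = (\<lambda>x. 0)"
    by (intro ip_definite diff_mem IH JH) (simp add: diff_mem IH JH)
  then show "J = I" by (simp add: fun_eq_iff)
qed (fact I)

lemma bochner_integrable_intoI:
  assumes fH: "\<And>w. w \<in> space M \<Longrightarrow> f w \<in> H"
    and s: "\<And>i::nat. simple_integrable_into H M (s i)"
    and int: "\<And>i. integrable M (\<lambda>w. fdist ip (f w) (s i w))"
    and lim: "(\<lambda>i. \<integral>w. fdist ip (f w) (s i w) \<partial>M) \<longlonglongrightarrow> 0"
  shows "bochner_integrable_into H ip M f"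
proof -
  define J where "J i = simple_integral_into M (s i)" for i
  define E where "E i = (\<integral>w. fdist ip (f w) (s i w) \<partial>M)" for i
  have sH: "w \<in> space M \<Longrightarrow> s i w \<in> H" for w i
    using s[of i] by (auto simp: simple_integrable_into_def)
  have JH: "J i \<in> H" for i
    unfolding J_def by (intro simple_integral_mem s)
  have E_lim: "E \<longlonglongrightarrow> 0" using lim by (simp add: E_def[abs_def])
  \<comment> \<open>Testing \<open>J m - J n\<close> against itself bounds its norm by the two errors.\<close>
  have dist: "fdist ip (J m) (J n) \<le> E m + E n" for m n
  proof -
    define u where "u = (\<lambda>x. J m x - J n x)"
    have u: "u \<in> H" by (simp add: u_def diff_mem JH)
    have le: "\<bar>ip (s m w) u - ip (s n w) u\<bar>
        \<le> (fdist ip (f w) (s m w) + fdist ip (f w) (s n w)) * fnorm ip u" if w: "w \<in> space M" for w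
      using ip_diff_le[OF fH[OF w] sH[OF w] u, of m] ip_diff_le[OF fH[OF w] sH[OF w] u, of n]
      by (simp add: algebra_simps)
    have si: "integrable M (\<lambda>w. ip (s i w) u)" for i
      using s u by (rule ip_simple_integral)
    have "(fnorm ip u)\<^sup>2 = (\<integral>w. ip (s m w) u - ip (s n w) u \<partial>M)"
      using si by (simp add: fnorm_sq u ip_simple_integral(2)[OF s u])
        (simp add: ip_diff JH u flip: J_def, simp add: u_def ip_diff JH diff_mem)
    also have "\<dots> \<le> (\<integral>w. (fdist ip (f w) (s m w) + fdist ip (f w) (s n w)) * fnorm ip u \<partial>M)"
      using si int le by (intro integral_mono) (auto intro: order_trans[OF abs_ge_self])
    also have "\<dots> = (E m + E n) * fnorm ip u"
      using int by (simp add: E_def)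
    finally have "fnorm ip u * fnorm ip u \<le> (E m + E n) * fnorm ip u"
      by (simp add: power2_eq_square)
    moreover have "0 \<le> E m + E n"
      unfolding E_def by (intro add_nonneg_nonneg Bochner_Integration.integral_nonneg fdist_nonneg fH sH)
    ultimately have "fnorm ip u \<le> E m + E n"
      using fnorm_nonneg[OF u] by (cases "fnorm ip u = 0") (auto simp: mult_le_cancel_right)
    then show ?thesis by (simp add: fdist_def u_def)
  qed
  have "\<exists>I\<in>H. (\<lambda>n. fdist ip (J n) I) \<longlonglongrightarrow> 0"
  proof (rule cauchy_convergent[OF JH])
    fix e :: real assume e: "0 < e"
    have "\<forall>\<^sub>F n in sequentially. E n < e / 2"
      using e by (intro order_tendstoD(2)[OF E_lim]) simp
    then obtain N where N: "\<And>n. N \<le> n \<Longrightarrow> E n < e / 2"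
      by (auto simp: eventually_sequentially)
    have "fdist ip (J m) (J n) < e" if "m \<ge> N" "n \<ge> N" for m n
      using dist[of m n] N[OF that(1)] N[OF that(2)] by simp
    then show "\<exists>N. \<forall>m\<ge>N. \<forall>n\<ge>N. fdist ip (J m) (J n) < e" by blast
  qed
  then obtain I where I: "I \<in> H" "(\<lambda>n. fdist ip (J n) I) \<longlonglongrightarrow> 0" by blast
  have "(\<integral>\<^sup>+ w. ennreal (fdist ip (f w) (s i w)) \<partial>M) = ennreal (E i)" for i
    unfolding E_def using int by (intro nn_integral_eq_integral) (auto intro!: AE_I2 fdist_nonneg fH sH)
  then have "(\<lambda>i. \<integral>\<^sup>+ w. ennreal (fdist ip (f w) (s i w)) \<partial>M) \<longlonglongrightarrow> 0"
    using tendsto_ennrealI[OF E_lim] by simp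
  then have "has_bochner_integral_into H ip M f I"
    unfolding has_bochner_integral_into_def
    using fH s int I by (intro conjI exI[of _ s]) (auto simp: J_def)
  then show ?thesis by (auto simp: bochner_integrable_into_def)
qed

end

section \<open>Reproducing kernels\<close>

locale rkhs =
  fixes K :: "'x \<Rightarrow> 'x \<Rightarrow> real" and H :: "('x \<Rightarrow> real) set" and ip :: "'x inner_prod"
  assumes is_rkhs: "is_rkhs K H ip"

sublocale rkhs \<subseteq> function_hilbert H ip
  using is_rkhs by unfold_locales (simp add: is_rkhs_def)

context rkhs
begin

abbreviation feature :: "'x \<Rightarrow> 'x \<Rightarrow> real" where
  "feature \<equiv> canonical_feature_map K"

lemma feature_mem: "feature x \<in> H"
  and reproducing: "f \<in> H \<Longrightarrow> ip f (feature x) = f x"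
  using is_rkhs by (simp_all add: is_rkhs_def)

lemma reproducing_left: "f \<in> H \<Longrightarrow> ip (feature x) f = f x"
  using ip_sym[OF feature_mem, of f x] by (simp add: reproducing)

lemma ip_feature: "ip (feature x) (feature y) = K x y"
  by (simp add: reproducing feature_mem) (simp add: canonical_feature_map_def)

lemma fdist_feature: "fdist ip (feature x) (feature y) = kdist K x y"
  by (simp add: fdist_def fnorm_def kdist_def ip_diff_diff feature_mem ip_feature)

lemma fdist_feature_zero: "fdist ip (feature x) (\<lambda>x. 0) = knorm K x"
  by (simp add: fdist_def fnorm_def knorm_def ip_feature)

text \<open>Truncating the feature vectors of \<open>p m\<close> to \<open>A m\<close> gives simple
  integrable functions whose distance to the integrand is exactly
  \<open>approx_error\<close>.\<close>

lemma bochner_integrable_feature: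
  assumes K: "pos_def_kernel K" and approx: "simple_approx K M y p A"
  shows "bochner_integrable_into H ip M (\<lambda>w. feature (y w))"
proof (rule bochner_integrable_intoI)
  define s where "s m w = (if w \<in> A m then feature (p m w) else (\<lambda>x. 0))" for m w
  have p: "simple_function M (p m)" "A m \<in> sets M" "emeasure M (A m) < \<infinity>"
    and int: "integrable M (approx_error K y (p m) (A m))"
    and lim: "(\<lambda>m. \<integral>w. approx_error K y (p m) (A m) w \<partial>M) \<longlonglongrightarrow> 0" for m
    using approx by (auto simp: simple_approx_def)
  have dist: "fdist ip (feature (y w)) (s m w) = approx_error K y (p m) (A m) w" for m w
    by (simp add: s_def approx_error_def fdist_feature fdist_feature_zero)
  show "feature (y w) \<in> H" for w by (rule feature_mem)
  show "simple_integrable_into H M (s m)" for m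
    unfolding simple_integrable_into_def
  proof (intro conjI)
    have "{w \<in> space M. w \<in> A m} \<in> sets M"
      using p(2) by measurable
    then show "simple_function M (s m)"
      unfolding s_def using simple_function_compose[OF p(1), of feature m]
      by (intro simple_function_If) (simp_all add: comp_def)
    show "s m ` space M \<subseteq> H" by (auto simp: s_def feature_mem zero_mem)
    have "emeasure M {w\<in>space M. s m w \<noteq> (\<lambda>x. 0)} \<le> emeasure M (A m)"
      using p(2) by (intro emeasure_mono) (auto simp: s_def)
    then show "emeasure M {w\<in>space M. s m w \<noteq> (\<lambda>x. 0)} < \<infinity>"
      using p(3) by (rule le_less_trans)
  qed
  show "integrable M (\<lambda>w. fdist ip (feature (y w)) (s m w))" for m
    unfolding dist by (rule int)
  show "(\<lambda>m. \<integral>w. fdist ip (feature (y w)) (s m w) \<partial>M) \<longlonglongrightarrow> 0"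
    unfolding dist by (rule lim)
qed

end

text \<open>By reproduction and Cauchy-Schwarz, \<open>u y - u x\<close> is bounded by
  \<open>kdist K y x * fnorm ip u\<close>, and \<open>kdist\<close> is continuous with
  \<open>K\<close>. This yields the measurability of scalar integrands that the Bochner integral
  lemmas ask for.\<close>

lemma rkhs_mem_continuous:
  fixes K :: "'x::topological_space \<Rightarrow> 'x \<Rightarrow> real"
  assumes "is_rkhs K H ip" and cont: "continuous_on UNIV (\<lambda>(x, y). K x y)" and u: "u \<in> H"
  shows "continuous_on UNIV u"
  unfolding continuous_on_def
proof (intro ballI)
  interpret rkhs K H ip by unfold_locales fact
  fix x
  have "((\<lambda>y. kdist K y x) \<longlongrightarrow> sqrt (K x x - 2 * K x x + K x x)) (at x)"
    unfolding kdist_def by (intro tendsto_intros tendsto_kernel[OF cont])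
  then have "((\<lambda>y. kdist K y x * fnorm ip u) \<longlongrightarrow> 0) (at x)"
    by (simp add: tendsto_mult_left_zero)
  then have "((\<lambda>y. u y - u x) \<longlongrightarrow> 0) (at x)"
    by (rule Lim_null_comparison[rotated])
      (use ip_diff_le[OF feature_mem feature_mem u] in
        \<open>simp add: reproducing_left u fdist_feature\<close>)
  then show "(u \<longlongrightarrow> u x) (at x)" by (simp add: LIM_zero_iff)
qed

text \<open>The integrability conjuncts guard against default values: \<open>integral\<close> is 0
  on functions that are not integrable, and the description behind
  \<open>bochner_integral_into\<close> says nothing when no integral exists.\<close>

theorem proposition3:
  fixes \<phi> :: "'g::{topological_group_add, t2_space} \<Rightarrow> 'x::polish_space \<Rightarrow> 'x"
    and k :: "'x \<Rightarrow> 'x \<Rightarrow> real"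
    and \<rho> :: "'x \<Rightarrow> real"
    and \<nu> :: "'g measure"
  assumes "locally_compact_space (euclidean :: 'g topology)"
    and "sigma_compact_space (euclidean :: 'g topology)"
    and "unimodular_group TYPE('g)"
    and "measurable_action \<phi>"
    and "pos_def_kernel k"
    and "\<forall>x. \<rho> x > 0"
    and "continuous_on UNIV (\<lambda>(x, y). k x y)" and "bounded (range (\<lambda>(x, y). k x y))"
    and "continuous_on UNIV \<rho>" and "bounded (range \<rho>)"
    and "\<nu> \<in> M_rho \<phi> \<rho>"
  defines "K \<equiv> weighted_kernel k \<rho>"
  defines "K\<^sub>\<nu> \<equiv> averaged_kernel \<nu> \<phi> K"
  defines "\<Phi> \<equiv> canonical_feature_map K"
  shows "(\<forall>x y. (\<forall>h. integrable \<nu> (\<lambda>g. K (\<phi> g x) (\<phi> h y))) \<and>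
                integrable \<nu> (\<lambda>h. \<integral>g. K (\<phi> g x) (\<phi> h y) \<partial>\<nu>)) \<and>
         (\<forall>H ip. is_rkhs K H ip \<longrightarrow>
            (\<forall>x. bochner_integrable_into H ip \<nu> (\<lambda>g. \<Phi> (\<phi> g x))) \<and>
            (\<forall>x y. K\<^sub>\<nu> x y =
               ip (averaged_feature_map H ip \<nu> \<phi> \<Phi> x) (averaged_feature_map H ip \<nu> \<phi> \<Phi> y)) \<and>
            is_feature_map H ip K\<^sub>\<nu> (averaged_feature_map H ip \<nu> \<phi> \<Phi>)) \<and>
         pos_def_kernel K\<^sub>\<nu>"
proof -
  have sets_\<nu> [measurable_cong]: "sets \<nu> = sets borel"
    and "sigma_finite_measure \<nu>"
    and sup: "(SUP x. \<integral>\<^sup>+ g. ennreal (\<rho> (\<phi> g x)) \<partial>\<nu>) < \<infinity>"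
    using \<open>\<nu> \<in> M_rho \<phi> \<rho>\<close> by (auto simp: M_rho_def)
  then interpret sigma_finite_measure \<nu> by simp
  have pd: "pos_def_kernel K"
    unfolding K_def by (intro weighted_kernel_pos_def assms)
  have \<rho>_cont: "continuous_on UNIV (\<lambda>z. \<rho> (f z))" if "continuous_on UNIV f" for f :: "'x \<times> 'x \<Rightarrow> 'x"
    using continuous_on_compose2[OF \<open>continuous_on UNIV \<rho>\<close> that] by simp
  have cont: "continuous_on UNIV (\<lambda>(x, y). K x y)"
    using assms(7) unfolding K_def weighted_kernel_def case_prod_beta
    by (intro continuous_intros \<rho>_cont)
  have action: "(\<lambda>(g, x). \<phi> g x) \<in> borel_measurable (borel \<Otimes>\<^sub>M borel)"
    using \<open>measurable_action \<phi>\<close> by (simp add: measurable_action_def)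
  have meas [measurable]: "(\<lambda>g. \<phi> g x) \<in> borel_measurable \<nu>" for x
  proof -
    have "(\<lambda>g. (g, x)) \<in> measurable \<nu> (borel \<Otimes>\<^sub>M borel)" by measurable
    from measurable_compose[OF this action] show ?thesis by simp
  qed
  obtain C where C: "\<And>x y. \<bar>k x y\<bar> \<le> C"
    using \<open>bounded (range (\<lambda>(x, y). k x y))\<close> by (force simp: bounded_iff)
  have norm_le: "knorm K x \<le> sqrt C * \<rho> x" for x
  proof -
    have "knorm K x = sqrt (k x x) * \<rho> x"
      using \<open>\<forall>x. \<rho> x > 0\<close>[rule_format, of x]
      by (simp add: knorm_def K_def weighted_kernel_def real_sqrt_mult mult_ac flip: power2_eq_square)
    also have "\<dots> \<le> sqrt C * \<rho> x"
      using C[of x x] \<open>\<forall>x. \<rho> x > 0\<close>[rule_format, of x] by (intro mult_right_mono) auto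
    finally show ?thesis .
  qed
  have norm_int: "integrable \<nu> (\<lambda>g. knorm K (\<phi> g x))" for x
  proof -
    have "(\<integral>\<^sup>+ g. ennreal (\<rho> (\<phi> g x)) \<partial>\<nu>) \<le> (SUP x. \<integral>\<^sup>+ g. ennreal (\<rho> (\<phi> g x)) \<partial>\<nu>)"
      by (rule SUP_upper) simp
    then have "(\<integral>\<^sup>+ g. ennreal (\<rho> (\<phi> g x)) \<partial>\<nu>) < \<infinity>"
      using sup by (rule le_less_trans)
    moreover have "(\<lambda>g. \<rho> (\<phi> g x)) \<in> borel_measurable \<nu>"
      using measurable_compose[OF meas borel_measurable_continuous_onI[OF \<open>continuous_on UNIV \<rho>\<close>]] .
    ultimately have "integrable \<nu> (\<lambda>g. \<rho> (\<phi> g x))"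
      using \<open>\<forall>x. \<rho> x > 0\<close> by (intro integrableI_nonneg) (auto simp: less_imp_le)
    then have bnd: "integrable \<nu> (\<lambda>g. sqrt C * \<rho> (\<phi> g x))" by simp
    have "(\<lambda>g. knorm K (\<phi> g x)) \<in> borel_measurable \<nu>"
      unfolding knorm_def using continuous_kernel_measurable[OF cont meas meas] by measurable
    then show ?thesis
      by (rule Bochner_Integration.integrable_bound[OF bnd])
        (auto intro!: AE_I2 intro: order_trans[OF norm_le abs_ge_self] simp: knorm_nonneg[OF pd])
  qed
  have int1: "integrable \<nu> (\<lambda>g. K (\<phi> g x) z)" for x z
    by (rule Bochner_Integration.integrable_bound[OF integrable_mult_left[OF norm_int[of x], of "knorm K z"]])
      (auto intro!: AE_I2 continuous_kernel_measurable[OF cont meas] intro: order_trans[OF kernel_cauchy_schwarz[OF pd]]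
        simp: knorm_nonneg[OF pd])
  have int2: "integrable \<nu> (\<lambda>h. \<integral>g. K (\<phi> g x) (\<phi> h y) \<partial>\<nu>)" for x y
  proof -
    have "(\<lambda>w. K (\<phi> (snd w) x) (\<phi> (fst w) y)) \<in> borel_measurable (\<nu> \<Otimes>\<^sub>M \<nu>)"
      by (intro continuous_kernel_measurable[OF cont] measurable_compose[OF _ meas]) measurable
    \<comment> \<open>Here \<sigma>-finiteness of \<nu> enters: it makes the partial integral of a
      jointly measurable function measurable.\<close>
    then have m: "(\<lambda>h. \<integral>g. K (\<phi> g x) (\<phi> h y) \<partial>\<nu>) \<in> borel_measurable \<nu>"
      by (intro borel_measurable_lebesgue_integral) (simp add: case_prod_beta)
    have le: "\<bar>\<integral>g. K (\<phi> g x) (\<phi> h y) \<partial>\<nu>\<bar> \<le> (\<integral>g. knorm K (\<phi> g x) \<partial>\<nu>) * knorm K (\<phi> h y)" for h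
    proof -
      have "\<bar>\<integral>g. K (\<phi> g x) (\<phi> h y) \<partial>\<nu>\<bar> \<le> (\<integral>g. \<bar>K (\<phi> g x) (\<phi> h y)\<bar> \<partial>\<nu>)"
        by (rule integral_abs_bound)
      also have "\<dots> \<le> (\<integral>g. knorm K (\<phi> g x) * knorm K (\<phi> h y) \<partial>\<nu>)"
        by (intro integral_mono integrable_abs int1 integrable_mult_left norm_int kernel_cauchy_schwarz pd)
      finally show ?thesis by simp
    qed
    show ?thesis
      by (rule Bochner_Integration.integrable_bound[OF integrable_mult_right[OF norm_int[of y],
            of "\<integral>g. knorm K (\<phi> g x) \<partial>\<nu>"] m])
        (auto intro!: AE_I2 intro: order_trans[OF le abs_ge_self])
  qed
  have pd\<^sub>\<nu>: "pos_def_kernel K\<^sub>\<nu>"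
    unfolding K\<^sub>\<nu>_def by (rule averaged_kernel_pos_def[OF pd cont meas norm_int int1 int2])
  have "(\<forall>x. bochner_integrable_into H ip \<nu> (\<lambda>g. \<Phi> (\<phi> g x))) \<and>
      is_feature_map H ip K\<^sub>\<nu> (averaged_feature_map H ip \<nu> \<phi> \<Phi>)" if "is_rkhs K H ip" for H ip
  proof -
    interpret rkhs K H ip by unfold_locales (fact that)
    have ex: "bochner_integrable_into H ip \<nu> (\<lambda>g. \<Phi> (\<phi> g x))" for x
      using simple_approx_exists[OF pd cont meas norm_int] bochner_integrable_feature[OF pd]
      unfolding \<Phi>_def by blast
    have ip_meas: "(\<lambda>g. ip (\<Phi> (\<phi> g x)) u) \<in> borel_measurable \<nu>" if "u \<in> H" for u x
      unfolding \<Phi>_def reproducing_left[OF that]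
      by (intro measurable_compose[OF meas] borel_measurable_continuous_onI
          rkhs_mem_continuous[OF is_rkhs] cont that)
    define I where "I = averaged_feature_map H ip \<nu> \<phi> \<Phi>"
    have I: "has_bochner_integral_into H ip \<nu> (\<lambda>g. \<Phi> (\<phi> g x)) (I x)" for x
    proof -
      obtain J where J: "has_bochner_integral_into H ip \<nu> (\<lambda>g. \<Phi> (\<phi> g x)) J"
        using ex[of x] by (auto simp: bochner_integrable_into_def)
      with bochner_integral_into_eq[OF J ip_meas] show ?thesis
        by (simp add: I_def averaged_feature_map_def)
    qed
    have IH: "I x \<in> H" for x
      using I[of x] by (simp add: has_bochner_integral_into_def)
    have ip_I: "ip (I x) u = (\<integral>g. u (\<phi> g x) \<partial>\<nu>)" if "u \<in> H" for x u
      using ip_bochner_integral[OF I that ip_meas[OF that]] that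
      by (simp add: \<Phi>_def reproducing_left)
    \<comment> \<open>Testing against the feature vector of \<open>z\<close> shows that the Bochner
      integral is also the pointwise integral.\<close>
    have I_apply: "I x z = (\<integral>g. K (\<phi> g x) z \<partial>\<nu>)" for x z
    proof -
      have "I x z = ip (I x) (feature z)" by (simp add: reproducing IH)
      also have "\<dots> = (\<integral>g. feature z (\<phi> g x) \<partial>\<nu>)" by (rule ip_I[OF feature_mem])
      finally show ?thesis
        by (simp add: canonical_feature_map_def pos_def_kernel_sym[OF pd, of z])
    qed
    have "K\<^sub>\<nu> x y = ip (I x) (I y)" for x y
    proof -
      \<comment> \<open>The inner integral is a value of \<open>I x\<close>, so \<open>I x\<close>
        itself can serve as the test vector for \<open>I y\<close>.\<close>
      have "K\<^sub>\<nu> x y = (\<integral>h. I x (\<phi> h y) \<partial>\<nu>)"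
        unfolding K\<^sub>\<nu>_def averaged_kernel_def I_apply ..
      also have "\<dots> = ip (I y) (I x)" by (rule ip_I[OF IH, symmetric])
      also have "\<dots> = ip (I x) (I y)" by (rule ip_sym[OF IH IH])
      finally show ?thesis .
    qed
    then show ?thesis
      using ex IH unfolding is_feature_map_def I_def by blast
  qed
  then show ?thesis
    using int1 int2 pd\<^sub>\<nu> unfolding is_feature_map_def by blast
qed

end
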